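(* Let $X$ be an abelian group, $A$ an associative algebra, and $f_1,\dots,f_r: X \to A$ maps. For $x \in X$ and $u_1,\dots,u_n \in X$: (1) (Boolean product rule) $$\Delta(f_1 \cdots f_r; x; u_1,\dots,u_n) = \sum_{\substack{J_1,\dots,J_r \subseteq [n] \\ J_1 \cup \cdots \cup J_r = [n]}} \Delta(f_1; x; u_{J_1}) \cdots \Delta(f_r; x; u_{J_r}).$$ (2) (Boolean Taylor product rule) $$(f_1 \cdots f_r)\big(x + \textstyle\sum_{i=1}^n u_i\big) = \sum_{J_1, \dots, J_r \subseteq [n]} \Delta(f_1; x; u_{J_1}) \cdots \Delta(f_r; x; u_{J_r}).$$ The sum in (1) runs over all ordered coverings $(J_1,\dots,J_r)$ of $[n]$: the $J_a$ may overlap, and empty $J_a$ are allowed.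
   Context: $[n]=\{1,\dots,n\}$; $f_1\cdots f_r$ is the pointwise product (in this order). For a map $h$ from $X$ to an abelian group and a finite family $(w_i)_{i\in I}$ in $X$, $\Delta(h;x;(w_i)_{i\in I})=\sum_{S\subseteq I}(-1)^{|I|-|S|}h(x+\sum_{i\in S}w_i)$; in particular $\Delta(h;x;u_\emptyset)=h(x)$. For $J\subseteq[n]$, $u_J=(u_i)_{i\in J}$. *)

theory Defs
  imports Complex_Main "HOL-Library.FuncSet"
begin

text \<open>
  Associative algebras over a commutative ring. The class \<^class>\<open>ring\<close> is associative, but neither
  commutative nor unital; the HOL-Algebra locale \<open>algebra\<close> would force commutativity.
\<close>

locale assoc_algebra = module scale
  for scale :: "'k::comm_ring_1 \<Rightarrow> 'a::ring \<Rightarrow> 'a" +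
  assumes scale_mult_left: "scale c a * b = scale c (a * b)"
    and scale_mult_right: "a * scale c b = scale c (a * b)"

definition is_unity :: "'a::ring \<Rightarrow> bool" where
  "is_unity e \<longleftrightarrow> (\<forall>a. e * a = a \<and> a * e = a)"

text \<open>
  Since there need not be a unit, \<^const>\<open>prod_list\<close> is not available. The empty product is the
  unit whenever one exists, and is meaningless otherwise.
\<close>

fun ordered_prod :: "'a::ring list \<Rightarrow> 'a" where
  "ordered_prod [] = (THE e. is_unity e)"
| "ordered_prod [a] = a"
| "ordered_prod (a # b # as) = a * ordered_prod (b # as)"

definition pointwise_prod :: "nat \<Rightarrow> (nat \<Rightarrow> 'x \<Rightarrow> 'a::ring) \<Rightarrow> 'x \<Rightarrow> 'a" where
  "pointwise_prod r f = (\<lambda>x. ordered_prod (map (\<lambda>a. f a x) [1..<Suc r]))"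

text \<open>
  The finite family \<open>(w i)\<close>, \<open>i \<in> I\<close>, is given by a finite set \<open>I\<close> and a function \<open>w\<close> of which
  only the values on \<open>I\<close> matter; the subfamily indexed by \<open>J \<subseteq> I\<close> is then given by \<open>J\<close> and the
  same \<open>w\<close>. The sign is written out by cases as the codomain is merely an abelian group.
\<close>

definition Delta ::
  "('x::ab_group_add \<Rightarrow> 'b::ab_group_add) \<Rightarrow> 'x \<Rightarrow> 'i set \<Rightarrow> ('i \<Rightarrow> 'x) \<Rightarrow> 'b" where
  "Delta h x I w =
     (\<Sum>S\<in>Pow I. if even (card I - card S) then h (x + (\<Sum>i\<in>S. w i)) else - h (x + (\<Sum>i\<in>S. w i)))"

text \<open>
  Tuples \<open>(J 1, \<dots>, J r)\<close> of subsets of \<open>{1..n}\<close>, as extensional functions on \<open>{1..r}\<close>, so that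
  every tuple is counted once.
\<close>

definition subset_tuples :: "nat \<Rightarrow> nat \<Rightarrow> (nat \<Rightarrow> nat set) set" where
  "subset_tuples r n = {1..r} \<rightarrow>\<^sub>E Pow {1..n}"

definition coverings :: "nat \<Rightarrow> nat \<Rightarrow> (nat \<Rightarrow> nat set) set" where
  "coverings r n = {J \<in> subset_tuples r n. (\<Union>a\<in>{1..r}. J a) = {1..n}}"

end

theory Submission
  imports Defs
begin

text \<open>
  Both rules are consequences of the Taylor expansion
  \<open>h (x + (\<Sum>i\<in>I. w i)) = (\<Sum>K\<in>Pow I. Delta h x K w)\<close> (lemma \<open>Boolean_Taylor\<close>) and of its
  converse: the values \<open>h (x + (\<Sum>i\<in>I. w i))\<close>, for \<open>I\<close> a finite set, are the subset sums of
  exactly one function on the finite sets \<open>K\<close>, so a function with these subset sums must agree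
  there with \<open>\<lambda>K. Delta h x K w\<close> (lemmas \<open>subset_sums_determine\<close> and \<open>Delta_unique\<close>).

  Expanding every factor of \<open>f 1 \<cdots> f r\<close> by the Taylor formula and multiplying out, with the order
  of the factors kept, gives the Boolean Taylor product rule, over an arbitrary finite index set
  \<open>I\<close>. Grouping the tuples \<open>(J 1, \<dots>, J r)\<close> in that rule by their union \<open>K \<subseteq> I\<close> turns its
  right-hand side into a subset sum, and the term belonging to \<open>K\<close> does not depend on \<open>I\<close>.
  By the uniqueness just mentioned this term is \<open>Delta (f 1 \<cdots> f r) x K w\<close>, and this is the Boolean
  product rule.
\<close>

text \<open>The subsets of \<open>insert i I\<close> that contain \<open>i\<close> correspond to the subsets of \<open>I\<close>.\<close>

lemma sum_Pow_insert:
  assumes "finite I" and "i \<notin> I"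
  shows "(\<Sum>S\<in>Pow (insert i I). g S) = (\<Sum>S\<in>Pow I. g S) + (\<Sum>S\<in>Pow I. g (insert i S))"
proof -
  have "inj_on (insert i) (Pow I)"
    using assms(2) by (auto simp: inj_on_def)
  moreover have "Pow I \<inter> insert i ` Pow I = {}"
    using assms(2) by auto
  ultimately show ?thesis
    using assms(1) by (simp add: Pow_insert sum.union_disjoint sum.reindex)
qed

lemma Delta_empty [simp]: "Delta h x {} w = h x"
  by (simp add: Delta_def)

text \<open>
  The recursion that makes \<^const>\<open>Delta\<close> an iterated difference: when \<open>i\<close> joins the index set,
  the subsets without \<open>i\<close> change sign, and those containing \<open>i\<close> keep it but move the base point.
\<close>

lemma Delta_insert:
  assumes I: "finite I" and i: "i \<notin> I"
  shows "Delta h x (insert i I) w = Delta h (x + w i) I w - Delta h x I w"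
proof -
  let ?t = "\<lambda>c S. if even (c - card S) then h (x + (\<Sum>j\<in>S. w j)) else - h (x + (\<Sum>j\<in>S. w j))"
  have "?t (card (insert i I)) S = - ?t (card I) S" if "S \<in> Pow I" for S
    using that I i by (auto simp: Suc_diff_le card_mono)
  then have without: "(\<Sum>S\<in>Pow I. ?t (card (insert i I)) S) = - Delta h x I w"
    by (simp add: Delta_def sum_negf[symmetric])
  have "?t (card (insert i I)) (insert i S) =
      (if even (card I - card S) then h (x + w i + (\<Sum>j\<in>S. w j))
       else - h (x + w i + (\<Sum>j\<in>S. w j)))" if "S \<in> Pow I" for S
  proof -
    have "finite S" "i \<notin> S"
      using that I i by (auto intro: finite_subset)
    then show ?thesis
      using I i by (simp add: add.assoc)
  qed
  then have within: "(\<Sum>S\<in>Pow I. ?t (card (insert i I)) (insert i S)) = Delta h (x + w i) I w"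
    by (simp add: Delta_def)
  show ?thesis
    unfolding Delta_def[of h x "insert i I"] sum_Pow_insert[OF assms] without within by simp
qed

text \<open>
  One step of the expansion: by \<open>Delta_insert\<close>, the terms for \<open>K\<close> and \<open>insert i K\<close> add up to the
  term for \<open>K\<close> at the base point \<open>x + w i\<close>.
\<close>

lemma Boolean_Taylor:
  assumes "finite I"
  shows "h (x + (\<Sum>i\<in>I. w i)) = (\<Sum>K\<in>Pow I. Delta h x K w)"
  using assms
proof (induction I arbitrary: x rule: finite_induct)
  case empty
  show ?case by simp
next
  case (insert i I)
  have "Delta h x K w + Delta h x (insert i K) w = Delta h (x + w i) K w" if "K \<in> Pow I" for K
  proof -
    have "finite K" "i \<notin> K"
      using that insert.hyps by (auto intro: finite_subset)
    then show ?thesis by (simp add: Delta_insert)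
  qed
  then have "(\<Sum>K\<in>Pow (insert i I). Delta h x K w) = (\<Sum>K\<in>Pow I. Delta h (x + w i) K w)"
    using insert.hyps by (simp add: sum_Pow_insert sum.distrib[symmetric])
  also have "\<dots> = h (x + w i + (\<Sum>j\<in>I. w j))"
    by (simp add: insert.IH)
  finally show ?case
    using insert.hyps by (simp add: add.assoc)
qed

text \<open>
  The uniqueness half of Moebius inversion on the finite sets: once the values on the proper
  subsets of \<open>I\<close> agree, the subset sums at \<open>I\<close> can only differ by their top terms.
\<close>

lemma subset_sums_determine:
  fixes g g' :: "'i set \<Rightarrow> 'b::ab_group_add"
  assumes sums: "\<And>I. finite I \<Longrightarrow> (\<Sum>K\<in>Pow I. g K) = (\<Sum>K\<in>Pow I. g' K)"
    and "finite I"
  shows "g I = g' I"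
  using \<open>finite I\<close>
proof (induction I rule: finite_psubset_induct)
  case (psubset I)
  have top: "(\<Sum>K\<in>Pow I. c K) = c I + (\<Sum>K\<in>Pow I - {I}. c K)" for c :: "'i set \<Rightarrow> 'b"
    using psubset.hyps by (intro sum.remove) auto
  have "(\<Sum>K\<in>Pow I - {I}. g K) = (\<Sum>K\<in>Pow I - {I}. g' K)"
    using psubset.IH by (intro sum.cong) auto
  with sums[OF psubset.hyps] show ?case
    by (simp add: top)
qed

corollary Delta_unique:
  assumes "\<And>I. finite I \<Longrightarrow> h (x + (\<Sum>i\<in>I. w i)) = (\<Sum>K\<in>Pow I. c K)" and "finite I"
  shows "Delta h x I w = c I"
proof (rule subset_sums_determine[OF _ \<open>finite I\<close>])
  fix I' :: "'a set" assume "finite I'"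
  then show "(\<Sum>K\<in>Pow I'. Delta h x K w) = (\<Sum>K\<in>Pow I'. c K)"
    using assms(1) Boolean_Taylor[of I' h x w] by simp
qed

text \<open>
  Distributivity for a product of sums with the factors in a fixed order. The product over the
  empty list occurs on both sides unmultiplied, so the identity extends to that case.
\<close>

lemma ordered_prod_sum:
  fixes g :: "'i \<Rightarrow> 's \<Rightarrow> 'a::ring"
  assumes "distinct xs"
  shows "ordered_prod (map (\<lambda>a. \<Sum>s\<in>A a. g a s) xs) =
    (\<Sum>J\<in>PiE (set xs) A. ordered_prod (map (\<lambda>a. g a (J a)) xs))"
  using assms
proof (induction xs)
  case Nil
  show ?case by simp
next
  case (Cons b bs)
  have b: "b \<notin> set bs" using Cons.prems by simp
  have "(\<Sum>J\<in>PiE (set (b # bs)) A. ordered_prod (map (\<lambda>a. g a (J a)) (b # bs))) =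
      (\<Sum>(s, J)\<in>A b \<times> PiE (set bs) A. ordered_prod (map (\<lambda>a. g a ((J(b := s)) a)) (b # bs)))"
    unfolding list.set PiE_insert_eq
    by (subst sum.reindex[OF inj_combinator[OF b]]) (simp add: case_prod_unfold comp_def)
  also have "\<dots> = (\<Sum>s\<in>A b. \<Sum>J\<in>PiE (set bs) A.
      ordered_prod (g b s # map (\<lambda>a. g a (J a)) bs))"
    unfolding sum.cartesian_product[symmetric]
    using b by (intro sum.cong refl arg_cong[where f = ordered_prod]) auto
  also have "\<dots> = ordered_prod (map (\<lambda>a. \<Sum>s\<in>A a. g a s) (b # bs))"
  proof (cases bs)
    case Nil
    then show ?thesis by simp
  next
    case (Cons c cs)
    have step: "ordered_prod (y # map k bs) = y * ordered_prod (map k bs)" for y :: 'a and k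
      using Cons by simp
    show ?thesis
      using Cons.IH Cons.prems by (simp add: step sum_product)
  qed
  finally show ?case by simp
qed

text \<open>
  The index set is left arbitrary because the inversion behind \<open>Boolean_product\<close> compares values
  on all finite index sets at once.
\<close>

lemma Boolean_Taylor_product:
  assumes "finite I"
  shows "pointwise_prod r f (x + (\<Sum>i\<in>I. w i)) =
    (\<Sum>J\<in>{1..r} \<rightarrow>\<^sub>E Pow I. ordered_prod (map (\<lambda>a. Delta (f a) x (J a) w) [1..<Suc r]))"
proof -
  have "{1..<Suc r} = {1..r}" by auto
  then show ?thesis
    unfolding pointwise_prod_def Boolean_Taylor[OF assms]
    using ordered_prod_sum[of "[1..<Suc r]" "\<lambda>a K. Delta (f a) x K w" "\<lambda>_. Pow I"]
    by (simp del: upt_Suc)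
qed

text \<open>
  The inner sum on the right ranges over the ordered coverings of \<open>K\<close> by subsets of \<open>K\<close>: a tuple
  with union \<open>K\<close> has all its entries inside \<open>K\<close>, so the ambient set \<open>I\<close> drops out. This is what makes
  the right-hand side a subset sum of a function of \<open>K\<close> alone.
\<close>

lemma sum_tuples_by_union:
  assumes "finite A" and "finite I"
  shows "(\<Sum>J\<in>A \<rightarrow>\<^sub>E Pow I. p J) = (\<Sum>K\<in>Pow I. \<Sum>J | J \<in> A \<rightarrow>\<^sub>E Pow K \<and> (\<Union>a\<in>A. J a) = K. p J)"
proof -
  have "(\<Sum>J\<in>A \<rightarrow>\<^sub>E Pow I. p J) =
      (\<Sum>K\<in>Pow I. \<Sum>J | J \<in> A \<rightarrow>\<^sub>E Pow I \<and> (\<Union>a\<in>A. J a) = K. p J)"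
    using assms by (intro sum.group[symmetric] finite_PiE) (auto dest: PiE_mem)
  also have "\<dots> = (\<Sum>K\<in>Pow I. \<Sum>J | J \<in> A \<rightarrow>\<^sub>E Pow K \<and> (\<Union>a\<in>A. J a) = K. p J)"
  proof (intro sum.cong refl)
    fix K assume "K \<in> Pow I"
    then have "J a \<subseteq> I \<longleftrightarrow> J a \<subseteq> K" if "(\<Union>a\<in>A. J a) = K" "a \<in> A" for J a
      using that by blast
    then show "{J \<in> A \<rightarrow>\<^sub>E Pow I. (\<Union>a\<in>A. J a) = K} = {J \<in> A \<rightarrow>\<^sub>E Pow K. (\<Union>a\<in>A. J a) = K}"
      unfolding PiE_iff Pow_iff by blast
  qed
  finally show ?thesis .
qed

text \<open>
  By the Taylor product rule, the sum over the ordered coverings of \<open>K\<close> has the subset sums that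
  characterize the differences of the product.
\<close>

theorem Boolean_product:
  fixes I :: "'i set"
  assumes "finite I"
  shows "Delta (pointwise_prod r f) x I w =
    (\<Sum>J | J \<in> {1..r} \<rightarrow>\<^sub>E Pow I \<and> (\<Union>a\<in>{1..r}. J a) = I.
      ordered_prod (map (\<lambda>a. Delta (f a) x (J a) w) [1..<Suc r]))" (is "_ = ?C I")
proof (rule Delta_unique[OF _ assms])
  fix I' :: "'i set" assume "finite I'"
  show "pointwise_prod r f (x + (\<Sum>i\<in>I'. w i)) = (\<Sum>K\<in>Pow I'. ?C K)"
    unfolding Boolean_Taylor_product[OF \<open>finite I'\<close>]
    by (rule sum_tuples_by_union[OF finite_atLeastAtMost \<open>finite I'\<close>])
qed

theorem theorem43:
  fixes scale :: "'k::comm_ring_1 \<Rightarrow> 'a::ring \<Rightarrow> 'a"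
    and f :: "nat \<Rightarrow> 'x::ab_group_add \<Rightarrow> 'a"
    and r n :: nat
    and x :: 'x
    and u :: "nat \<Rightarrow> 'x"
  assumes "assoc_algebra scale"
    and "r = 0 \<Longrightarrow> \<exists>e::'a. is_unity e"
  shows "Delta (pointwise_prod r f) x {1..n} u =
           (\<Sum>J\<in>coverings r n. ordered_prod (map (\<lambda>a. Delta (f a) x (J a) u) [1..<Suc r]))
         \<and> pointwise_prod r f (x + (\<Sum>i\<in>{1..n}. u i)) =
           (\<Sum>J\<in>subset_tuples r n. ordered_prod (map (\<lambda>a. Delta (f a) x (J a) u) [1..<Suc r]))"
  unfolding coverings_def subset_tuples_def
  by (intro conjI Boolean_product Boolean_Taylor_product finite_atLeastAtMost)

end
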